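(* Let $p$ be prime, $r,k\ge1$, and $\mu\in\mathrm{GL}_r(\mathbb{Z}_p)$ with $\mu^p=I$. For $b\in\{0,\dots,p-1\}$ let $M_b:=\sum_{i=0}^{b-1}\mu^i$. For $x\in(\mathbb{Z}_p^r)^k$ and $w\in\mathbb{Z}_p^r$ let $\eta^x_w:=|\{b\in\{0,\dots,p-1\}^k:\sum_{j=1}^k M_{b_j}x_j=w\}|$. For $(x,w)$ uniformly random, $\mathbb{E}[\eta^x_w]=p^{k-r}$ and $\mathrm{Var}(\eta^x_w)=p^{k-r}(1-p^{-r})$. *)

theory Defs
  imports "HOL-Analysis.Analysis" "Berlekamp_Zassenhaus.Finite_Field"
begin

text \<open>Z_p is rendered as the prime field 'p mod_ring (CARD('p) = p prime);
  Z_p^r as 'p mod_ring ^ 'r with CARD('r) = r; k-tuples as functions on a finite type 'k.\<close>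

definition matpow :: "'a::semiring_1 ^'n^'n \<Rightarrow> nat \<Rightarrow> 'a^'n^'n" where
  "matpow A n = (((**) A) ^^ n) (mat 1)"

definition Mb :: "'a::semiring_1 ^'n^'n \<Rightarrow> nat \<Rightarrow> 'a^'n^'n" where
  "Mb \<mu> b = (\<Sum>i<b. matpow \<mu> i)"

definition eta :: "'p::prime_card mod_ring ^'r^'r \<Rightarrow> ('k::finite \<Rightarrow> 'p mod_ring ^'r)
                    \<Rightarrow> 'p mod_ring ^'r \<Rightarrow> nat" where
  "eta \<mu> x w = card {b :: 'k \<Rightarrow> nat. (\<forall>j. b j < CARD('p)) \<and>
                         (\<Sum>j\<in>UNIV. Mb \<mu> (b j) *v x j) = w}"

end

(*
  Write F x b = \<Sum>j. M_(b j) x_j, so that eta x w counts the digit tuples b in {0..p-1}^k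
  with F x b = w. Summing over w gives p^k for every x, whence the mean p^(k-r).
  The sum over w of (eta x w)^2 counts the pairs (b, b') with F x b = F x b'. If b j0 \<noteq> b' j0,
  then M_(b j0) - M_(b' j0) is injective: it equals \<mu>^(b' j0) M_c with c = b j0 - b' j0 a unit
  mod p, and M_c v = 0 forces \<mu>^c v = v, hence \<mu> v = v and M_c v = c v. So x \<mapsto> F x b - F x b'
  is an additive surjection onto Z_p^r and such a pair collides for exactly a p^(-r) fraction
  of all x. The second moment is therefore p^(k-r) (1 + (p^k - 1) p^(-r)), and the variance
  follows.
*)
theory Submission
  imports Defs "HOL-Number_Theory.Cong" "HOL-Library.Function_Algebras"
begin

lemma matpow_0 [simp]: "matpow A 0 = mat 1"
  by (simp add: matpow_def)

lemma matpow_Suc: "matpow A (Suc n) = A ** matpow A n"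
  by (simp add: matpow_def)

lemma matpow_add: "matpow A (m + n) = matpow A m ** matpow A n"
  by (induction m) (simp_all add: matpow_Suc matrix_mul_assoc)

lemma matpow_mult_eq_id:
  assumes "matpow A p = mat 1"
  shows "matpow A (p * q) = mat 1"
  using assms by (induction q) (simp_all add: matpow_add)

lemma matpow_mult: "matpow A (m * n) = matpow (matpow A m) n"
  by (induction n) (simp_all add: matpow_Suc matpow_add)

lemma matpow_mod:
  assumes "matpow A p = mat 1"
  shows "matpow A n = matpow A (n mod p)"
  using matpow_add[of A "p * (n div p)" "n mod p"] matpow_mult_eq_id[OF assms] by simp

lemma matpow_mult_vec_fixed:
  assumes "A *v v = v"
  shows "matpow A n *v v = v"
  using assms by (induction n) (simp_all add: matpow_Suc flip: matrix_vector_mul_assoc)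

lemma Mb_0 [simp]: "Mb A 0 = 0"
  by (simp add: Mb_def)

lemma Mb_Suc: "Mb A (Suc n) = Mb A n + matpow A n"
  by (simp add: Mb_def)

lemma Mb_add: "Mb A (m + n) = Mb A m + matpow A m ** Mb A n"
  by (induction n) (simp_all add: Mb_def matpow_add matrix_add_ldistrib add.assoc)

lemma Mb_geometric: "A ** Mb A n + mat 1 = matpow A n + Mb A n"
proof (induction n)
  case (Suc n)
  have "A ** Mb A (Suc n) + mat 1 = (A ** Mb A n + mat 1) + A ** matpow A n"
    by (simp add: Mb_Suc matrix_add_ldistrib add_ac)
  also have "\<dots> = matpow A (Suc n) + Mb A (Suc n)"
    unfolding Suc.IH by (simp add: Mb_Suc matpow_Suc add_ac)
  finally show ?case .
qed simp

lemma Mb_mult_vec_fixed: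
  fixes A :: "'a::comm_ring_1^'n^'n"
  assumes "A *v v = v"
  shows "Mb A n *v v = of_nat n *s v"
  by (induction n) (simp_all add: Mb_Suc matrix_vector_mult_add_rdistrib
      matpow_mult_vec_fixed[OF assms] algebra_simps)

lemma Mb_mult_vec_eq_0_iff:
  fixes \<mu> :: "'p::prime_card mod_ring ^'r::finite^'r"
  assumes period: "matpow \<mu> CARD('p) = mat 1"
    and c: "0 < c" "c < CARD('p)"
  shows "Mb \<mu> c *v v = 0 \<longleftrightarrow> v = 0"
proof
  assume Mv: "Mb \<mu> c *v v = 0"
  have "(\<mu> ** Mb \<mu> c + mat 1) *v v = (matpow \<mu> c + Mb \<mu> c) *v v"
    by (simp only: Mb_geometric)
  then have fixed_c: "matpow \<mu> c *v v = v"
    by (simp add: Mv matrix_vector_mult_add_rdistrib flip: matrix_vector_mul_assoc)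
  have "coprime c CARD('p)"
    using c prime_card[where 'a='p] by (metis coprime_commute nat_dvd_not_less prime_imp_coprime)
  then obtain a where "[c * a = 1] (mod CARD('p))"
    using cong_solve_coprime_nat by auto
  then have "(c * a) mod CARD('p) = 1"
    using prime_gt_1_nat[OF prime_card[where 'a='p]] by (simp add: cong_def)
  then have "matpow \<mu> (c * a) = \<mu>"
    using matpow_mod[OF period, of "c * a"] by (simp add: matpow_Suc)
  then have "\<mu> *v v = v"
    using matpow_mult_vec_fixed[OF fixed_c, of a] by (simp add: matpow_mult)
  then have "of_nat c *s v = 0"
    using Mv by (simp add: Mb_mult_vec_fixed)
  moreover have "(of_nat c :: 'p mod_ring) \<noteq> 0"
    using of_nat_0_mod_ring_dvd[where 'a='p] c by (metis nat_dvd_not_less)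
  ultimately show "v = 0"
    by simp
qed simp

lemma Mb_mult_vec_eq_iff:
  fixes \<mu> :: "'p::prime_card mod_ring ^'r::finite^'r"
  assumes period: "matpow \<mu> CARD('p) = mat 1"
    and "b < CARD('p)" "b' < CARD('p)"
  shows "Mb \<mu> b *v v = Mb \<mu> b' *v v \<longleftrightarrow> b = b' \<or> v = 0"
proof -
  have "v = 0" if lt: "b' < b" "b < CARD('p)" and eq: "Mb \<mu> b *v v = Mb \<mu> b' *v v" for b b'
  proof -
    define c where "c = b - b'"
    have "matpow \<mu> b' *v (Mb \<mu> c *v v) = 0"
      using eq lt Mb_add[of \<mu> b' c]
      by (simp add: c_def matrix_vector_mult_add_rdistrib flip: matrix_vector_mul_assoc)
    then have "matpow \<mu> (CARD('p) - b' + b') *v (Mb \<mu> c *v v) = 0"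
      by (simp add: matpow_add flip: matrix_vector_mul_assoc)
    then have "Mb \<mu> c *v v = 0"
      using lt period by simp
    then show "v = 0"
      using Mb_mult_vec_eq_0_iff[OF period] lt by (simp add: c_def)
  qed
  then show ?thesis
    using assms by (cases b b' rule: linorder_cases) auto
qed

lemma sum_card_fibers:
  fixes f :: "'a \<Rightarrow> 'w::finite"
  assumes "finite B"
  shows "(\<Sum>w\<in>UNIV. card {b\<in>B. f b = w}) = card B"
  using sum.group[OF assms finite subset_UNIV, where g = f and h = "\<lambda>_. 1::nat"] by simp

lemma sum_card_fibers_squared:
  fixes f :: "'a \<Rightarrow> 'w::finite"
  assumes "finite B"
  shows "(\<Sum>w\<in>UNIV. card {b\<in>B. f b = w} ^ 2) = card {(b, b')\<in>B \<times> B. f b = f b'}"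
proof -
  let ?P = "{(b, b')\<in>B \<times> B. f b = f b'}"
  have "{q\<in>?P. f (fst q) = w} = {b\<in>B. f b = w} \<times> {b\<in>B. f b = w}" for w
    by auto
  then have "(\<Sum>w\<in>UNIV. card {q\<in>?P. f (fst q) = w}) = (\<Sum>w\<in>UNIV. card {b\<in>B. f b = w} ^ 2)"
    by (simp add: card_cartesian_product power2_eq_square)
  moreover have "(\<Sum>w\<in>UNIV. card {q\<in>?P. f (fst q) = w}) = card ?P"
    using assms by (intro sum_card_fibers) (auto intro: finite_subset[of _ "B \<times> B"])
  ultimately show ?thesis
    by simp
qed

lemma sum_card_swap:
  assumes "finite A" "finite B"
  shows "(\<Sum>a\<in>A. card {b\<in>B. R a b}) = (\<Sum>b\<in>B. card {a\<in>A. R a b})"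
  using assms sum.swap[where g = "\<lambda>a b. if R a b then 1::nat else 0" and A = A and B = B]
  by (simp add: sum.If_cases Int_def)

lemma card_fiber_additive_surj:
  fixes g :: "'a::{ab_group_add,finite} \<Rightarrow> 'b::{ab_group_add,finite}"
  assumes add: "\<And>x y. g (x + y) = g x + g y" and "surj g"
  shows "card {x. g x = c} * CARD('b) = CARD('a)"
proof -
  define K where "K = card {x. g x = 0}"
  have kernel: "card {x. g x = c} = K" for c
  proof -
    obtain a where a: "g a = c"
      using \<open>surj g\<close> by (metis surjD)
    have "{x. g x = c} = (\<lambda>x. x + a) ` {x. g x = 0}"
    proof (rule Set.set_eqI, rule iffI)
      fix x assume "x \<in> {x. g x = c}"
      then have "g (x - a) = 0"
        using a add[of "x - a" a] by simp
      then show "x \<in> (\<lambda>x. x + a) ` {x. g x = 0}"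
        by (intro image_eqI[where x = "x - a"]) simp_all
    next
      fix y assume "y \<in> (\<lambda>x. x + a) ` {x. g x = 0}"
      then show "y \<in> {x. g x = c}"
        using a by (auto simp only: add) simp
    qed
    then show ?thesis
      by (simp add: card_image K_def)
  qed
  have "CARD('a) = (\<Sum>c\<in>UNIV. card {x. g x = c})"
    using sum_card_fibers[of UNIV g] by simp
  then show ?thesis
    by (simp add: kernel)
qed

lemma card_sum_matrix_vector_eq_0:
  fixes D :: "'k::finite \<Rightarrow> 'a::{comm_ring_1,finite}^'n^'n"
  assumes "inj ((*v) (D j0))"
  shows "card {x::'k \<Rightarrow> 'a^'n. (\<Sum>j\<in>UNIV. D j *v x j) = 0} * CARD('a^'n) = CARD('k \<Rightarrow> 'a^'n)"
proof (rule card_fiber_additive_surj)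
  show "(\<Sum>j\<in>UNIV. D j *v (x + y) j) = (\<Sum>j\<in>UNIV. D j *v x j) + (\<Sum>j\<in>UNIV. D j *v y j)"
    for x y :: "'k \<Rightarrow> 'a^'n"
    by (simp add: matrix_vector_right_distrib sum.distrib)
  show "surj (\<lambda>x::'k \<Rightarrow> 'a^'n. \<Sum>j\<in>UNIV. D j *v x j)"
  proof -
    have "surj ((*v) (D j0))"
      using assms by (simp add: finite_UNIV_inj_surj)
    have "c \<in> range (\<lambda>x::'k \<Rightarrow> 'a^'n. \<Sum>j\<in>UNIV. D j *v x j)" for c
    proof -
      obtain u where u: "D j0 *v u = c"
        using \<open>surj ((*v) (D j0))\<close> by (metis surjD)
      have "(\<Sum>j\<in>UNIV. D j *v (if j = j0 then u else 0)) = c"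
        using u by (simp add: if_distrib[of "(*v) _"] cong: if_cong)
      then show ?thesis
        using range_eqI[of c "\<lambda>x. \<Sum>j\<in>UNIV. D j *v x j" "\<lambda>j. if j = j0 then u else 0"]
        by simp
    qed
    then show ?thesis
      by blast
  qed
qed

lemma eta_eq_card_fibers:
  fixes \<mu> :: "'p::prime_card mod_ring ^'r::finite^'r"
  shows "eta \<mu> x = (\<lambda>w. card {b\<in>UNIV \<rightarrow>\<^sub>E {..<CARD('p)}. (\<Sum>j\<in>UNIV. Mb \<mu> (b j) *v x j) = w})"
  unfolding eta_def by (simp add: PiE_UNIV_domain Pi_iff)

lemma sum_eta:
  fixes \<mu> :: "'p::prime_card mod_ring ^'r::finite^'r" and x :: "'k::finite \<Rightarrow> 'p mod_ring^'r"
  shows "(\<Sum>w\<in>UNIV. eta \<mu> x w) = CARD('p) ^ CARD('k)"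
  unfolding eta_eq_card_fibers by (simp add: sum_card_fibers finite_PiE card_PiE)

lemma sum_eta_squared:
  fixes \<mu> :: "'p::prime_card mod_ring ^'r::finite^'r" and x :: "'k::finite \<Rightarrow> 'p mod_ring^'r"
  shows "(\<Sum>w\<in>UNIV. eta \<mu> x w ^ 2) =
    card {(b, b')\<in>(UNIV \<rightarrow>\<^sub>E {..<CARD('p)}) \<times> (UNIV \<rightarrow>\<^sub>E {..<CARD('p)}).
      (\<Sum>j\<in>UNIV. Mb \<mu> (b j) *v x j) = (\<Sum>j\<in>UNIV. Mb \<mu> (b' j) *v x j)}"
  unfolding eta_eq_card_fibers by (simp add: sum_card_fibers_squared finite_PiE)

lemma card_Mb_sums_eq:
  fixes \<mu> :: "'p::prime_card mod_ring ^'r::finite^'r"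
  assumes period: "matpow \<mu> CARD('p) = mat 1"
    and b: "b \<in> UNIV \<rightarrow>\<^sub>E {..<CARD('p)}" "b' \<in> UNIV \<rightarrow>\<^sub>E {..<CARD('p)}" and "b \<noteq> b'"
  shows "card {x::'k::finite \<Rightarrow> 'p mod_ring^'r.
      (\<Sum>j\<in>UNIV. Mb \<mu> (b j) *v x j) = (\<Sum>j\<in>UNIV. Mb \<mu> (b' j) *v x j)} * CARD('p mod_ring^'r)
    = CARD('k \<Rightarrow> 'p mod_ring^'r)"
proof -
  obtain j0 where j0: "b j0 \<noteq> b' j0"
    using \<open>b \<noteq> b'\<close> by auto
  define D where "D j = Mb \<mu> (b j) - Mb \<mu> (b' j)" for j
  have inj: "inj ((*v) (D j0))"
  proof (rule injI)
    fix u1 u2 assume "D j0 *v u1 = D j0 *v u2"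
    then have "Mb \<mu> (b j0) *v (u1 - u2) = Mb \<mu> (b' j0) *v (u1 - u2)"
      by (simp add: D_def matrix_vector_mult_diff_rdistrib matrix_vector_mult_diff_distrib)
        (simp add: algebra_simps)
    then show "u1 = u2"
      using Mb_mult_vec_eq_iff[OF period] b j0 by (auto simp: PiE_iff)
  qed
  have "{x::'k \<Rightarrow> 'p mod_ring^'r.
      (\<Sum>j\<in>UNIV. Mb \<mu> (b j) *v x j) = (\<Sum>j\<in>UNIV. Mb \<mu> (b' j) *v x j)}
    = {x. (\<Sum>j\<in>UNIV. D j *v x j) = 0}"
    by (simp add: D_def matrix_vector_mult_diff_rdistrib sum_subtractf)
  with card_sum_matrix_vector_eq_0[of D j0, OF inj] show ?thesis
    by simp
qed

lemma sum_diagonal: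
  assumes "finite B"
  shows "(\<Sum>q\<in>B \<times> B. if fst q = snd q then t else 0) = card B * t"
proof -
  have "(\<Sum>q\<in>B \<times> B. if fst q = snd q then t else 0) = (\<Sum>b\<in>B. \<Sum>b'\<in>B. if b = b' then t else 0)"
    by (simp add: sum.cartesian_product split_def)
  then show ?thesis
    using assms by simp
qed

lemma sum_sum_eta_squared:
  fixes \<mu> :: "'p::prime_card mod_ring ^'r::finite^'r"
  assumes period: "matpow \<mu> CARD('p) = mat 1"
  defines "V \<equiv> CARD('p mod_ring^'r)" and "X \<equiv> CARD('k::finite \<Rightarrow> 'p mod_ring^'r)"
    and "n \<equiv> CARD('p) ^ CARD('k)"
  shows "V * (\<Sum>x\<in>(UNIV :: ('k \<Rightarrow> 'p mod_ring^'r) set). \<Sum>w\<in>UNIV. eta \<mu> x w ^ 2)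
    = X * (n ^ 2 + n * (V - 1))"
proof -
  define B where "B = (UNIV :: 'k set) \<rightarrow>\<^sub>E {..<CARD('p)}"
  define F where "F x b = (\<Sum>j\<in>UNIV. Mb \<mu> (b j) *v x j)" for x :: "'k \<Rightarrow> 'p mod_ring^'r" and b
  define C where "C q = card {x. F x (fst q) = F x (snd q)}" for q
  have B: "finite B" "card B = n"
    by (simp_all add: B_def finite_PiE card_PiE n_def)
  have "V * C q = X + (if fst q = snd q then (V - 1) * X else 0)" if "q \<in> B \<times> B" for q
  proof (cases "fst q = snd q")
    case True
    have "V > 0"
      by (simp add: V_def)
    with True show ?thesis
      by (simp add: C_def X_def algebra_simps)
  next
    case False
    then show ?thesis
      using card_Mb_sums_eq[OF period, of "fst q" "snd q"] that
      by (simp add: C_def F_def B_def V_def X_def mult.commute mem_Times_iff)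
  qed
  then have "V * (\<Sum>q\<in>B \<times> B. C q) = (\<Sum>q\<in>B \<times> B. X + (if fst q = snd q then (V - 1) * X else 0))"
    by (simp add: sum_distrib_left)
  also have "\<dots> = X * (n ^ 2 + n * (V - 1))"
    using B by (simp add: sum.distrib sum_diagonal power2_eq_square algebra_simps)
  also have "(\<Sum>q\<in>B \<times> B. C q) = (\<Sum>x\<in>UNIV. card {q\<in>B \<times> B. F x (fst q) = F x (snd q)})"
    using sum_card_swap[of UNIV "B \<times> B" "\<lambda>x q. F x (fst q) = F x (snd q)"] B
    by (simp add: C_def)
  also have "\<dots> = (\<Sum>x\<in>(UNIV :: ('k \<Rightarrow> 'p mod_ring^'r) set). \<Sum>w\<in>UNIV. eta \<mu> x w ^ 2)"
    by (intro sum.cong refl) (simp add: sum_eta_squared F_def B_def split_def mem_Times_iff)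
  finally show ?thesis .
qed

lemma sum_sum_power2_diff:
  fixes f :: "'a \<Rightarrow> 'b \<Rightarrow> real"
  shows "(\<Sum>x\<in>A. \<Sum>y\<in>B. (f x y - m) ^ 2)
    = (\<Sum>x\<in>A. \<Sum>y\<in>B. f x y ^ 2) - 2 * m * (\<Sum>x\<in>A. \<Sum>y\<in>B. f x y) + real (card A * card B) * m ^ 2"
  by (simp add: power2_diff sum.distrib sum_subtractf sum_distrib_left algebra_simps)

theorem mainTheorem11:
  fixes \<mu> :: "'p::prime_card mod_ring ^'r::finite^'r"
  assumes "invertible \<mu>"
    and "matpow \<mu> CARD('p) = mat 1"
  defines "N \<equiv> real (CARD('k::finite \<Rightarrow> 'p mod_ring ^'r) * CARD('p mod_ring ^'r))"
  defines "E \<equiv> (\<Sum>x\<in>(UNIV :: ('k \<Rightarrow> 'p mod_ring ^'r) set). \<Sum>w\<in>UNIV. real (eta \<mu> x w)) / N"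
  shows "E = real CARD('p) powr (real CARD('k) - real CARD('r)) \<and>
         (\<Sum>x\<in>(UNIV :: ('k \<Rightarrow> 'p mod_ring ^'r) set). \<Sum>w\<in>UNIV. (real (eta \<mu> x w) - E)^2) / N
         = real CARD('p) powr (real CARD('k) - real CARD('r)) * (1 - real CARD('p) powr (- real CARD('r)))"
proof -
  define X where "X = real CARD('k \<Rightarrow> 'p mod_ring ^'r)"
  define V where "V = real CARD('p mod_ring ^'r)"
  define n where "n = real (CARD('p) ^ CARD('k))"
  have "X > 0" "V > 0"
    by (simp_all add: X_def V_def)
  have N: "N = X * V"
    by (simp add: N_def X_def V_def)
  have S1: "(\<Sum>x\<in>(UNIV :: ('k \<Rightarrow> 'p mod_ring ^'r) set). \<Sum>w\<in>UNIV. real (eta \<mu> x w)) = X * n"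
    by (simp add: X_def n_def sum_eta flip: of_nat_sum)
  have "V * (\<Sum>x\<in>(UNIV :: ('k \<Rightarrow> 'p mod_ring ^'r) set). \<Sum>w\<in>UNIV. real (eta \<mu> x w) ^ 2)
      = X * (n ^ 2 + n * (V - 1))"
    using arg_cong[OF sum_sum_eta_squared[OF assms(2), where 'k = 'k], of real] \<open>V > 0\<close>
    by (simp add: X_def V_def n_def of_nat_diff of_nat_sum)
  then have S2: "(\<Sum>x\<in>(UNIV :: ('k \<Rightarrow> 'p mod_ring ^'r) set). \<Sum>w\<in>UNIV. real (eta \<mu> x w) ^ 2)
      = X * (n ^ 2 + n * (V - 1)) / V"
    using \<open>V > 0\<close> by (simp add: eq_divide_eq mult.commute)
  have E: "E = n / V"
    using \<open>X > 0\<close> by (simp add: E_def S1 N)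
  have powr_k_r: "real CARD('p) powr (real CARD('k) - real CARD('r)) = n / V"
    and powr_r: "real CARD('p) powr (- real CARD('r)) = 1 / V"
    by (simp_all add: n_def V_def powr_diff powr_minus powr_realpow CARD_vec CARD_mod_ring divide_inverse)
  show ?thesis
    unfolding sum_sum_power2_diff S1 S2 N_def[symmetric] unfolding E N powr_k_r powr_r
    using \<open>X > 0\<close> \<open>V > 0\<close> by (simp add: field_simps power2_eq_square)
qed

end
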